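(* Let $S=\{s_1,\dots,s_6\}\subset\mathbb{R}^4$ be six points in general linear position, and let $u_i,v_i,u_i^*,v_i^*$ ($i=1,\dots,4$) be the vectors associated to $S$ and to a double covering $T_1,\dots,T_4$ as in the context, with $\{u_i\}$ and $\{v_i\}$ each a basis of $\mathbb{R}^4$. Let $Q_i(x)=\langle x,u_i\rangle\langle x,v_i\rangle$ for $i=1,\dots,4$ and let $Q=\alpha_1Q_1+\alpha_2Q_2+\alpha_3Q_3+\alpha_4Q_4$ with $\alpha_j\in\mathbb{R}$. Then for all $i=1,\dots,4$ $$\langle v_i^*,u_i\rangle\,Q(u_i^* )=\langle u_i^*,v_i\rangle\,Q(v_i^* ),$$ and hence $$\langle v_i^*,u_i\rangle^2\,Q^2(u_i^* )=\langle u_i^*,v_i\rangle^2\,Q^2(v_i^* ).$$ On the other hand, the quartic form $R(x)=\langle x,u_1\rangle\langle x,u_2\rangle\langle x,u_3\rangle\langle x,u_4\rangle$ satisfies none of these constraints: for every $i=1,\dots,4$, $$\langle v_i^*,u_i\rangle^2\,R(u_i^* )\neq\langle u_i^*,v_i\rangle^2\,R(v_i^* ).$$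
   Context: General linear position means any four of the six vectors $s_1,\dots,s_6$ are linearly independent. $\langle\cdot,\cdot\rangle$ is the standard inner product on $\mathbb{R}^4$; $Q^2(x)$ means $(Q(x))^2$. Double covering: $T_1,T_2,T_3,T_4$ are 3-element subsets of $\{1,\dots,6\}$ such that any two of them intersect in exactly one element and each element of $\{1,\dots,6\}$ lies in precisely two of them (for example $\{1,2,3\},\{1,4,5\},\{2,4,6\},\{3,5,6\}$). $\overline{T}_i$ is the complement of $T_i$ in $\{1,\dots,6\}$. For a triple $T=\{t_1,t_2,t_3\}$, $L_T$ is the hyperplane spanned by $s_{t_1},s_{t_2},s_{t_3}$. $u_i$ is a unit vector perpendicular to $L_{T_i}$ and $v_i$ is a unit vector perpendicular to $L_{\overline{T}_i}$ (signs chosen arbitrarily). $u_1^*,\dots,u_4^*$ is the dual basis of $u_1,\dots,u_4$: $\langle u_i^*,u_j\rangle=1$ if $i=j$ and $0$ otherwise; $v_1^*,\dots,v_4^*$ is defined in the same way from $v_1,\dots,v_4$. *)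

theory Defs
  imports "HOL-Analysis.Analysis"
begin

text \<open>
  The six vectors are indexed by \<open>{1..6::nat}\<close>, and the triples and the normal vectors
  by \<open>{1..4::nat}\<close>; values of the indexing functions outside these ranges play no role.
\<close>

text \<open>Independence is meant for indexed families, so coinciding vectors have to be excluded
  explicitly before passing to the image set.\<close>

definition independent_family :: "(nat \<Rightarrow> real^4) \<Rightarrow> nat set \<Rightarrow> bool" where
  "independent_family w I \<longleftrightarrow> inj_on w I \<and> independent (w ` I)"

definition general_linear_position :: "(nat \<Rightarrow> real^4) \<Rightarrow> bool" where
  "general_linear_position s \<longleftrightarrow>
     (\<forall>I. I \<subseteq> {1..6} \<and> card I = 4 \<longrightarrow> independent_family s I)"

definition double_covering :: "(nat \<Rightarrow> nat set) \<Rightarrow> bool" where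
  "double_covering T \<longleftrightarrow>
     (\<forall>i\<in>{1..4}. T i \<subseteq> {1..6} \<and> card (T i) = 3) \<and>
     (\<forall>i\<in>{1..4}. \<forall>j\<in>{1..4}. i \<noteq> j \<longrightarrow> card (T i \<inter> T j) = 1) \<and>
     (\<forall>k\<in>{1..6}. card {i\<in>{1..4}. k \<in> T i} = 2)"

definition hyperplane_of :: "(nat \<Rightarrow> real^4) \<Rightarrow> nat set \<Rightarrow> (real^4) set" where
  "hyperplane_of s A = span (s ` A)"

definition unit_normal :: "real^4 \<Rightarrow> (real^4) set \<Rightarrow> bool" where
  "unit_normal n L \<longleftrightarrow> norm n = 1 \<and> (\<forall>x\<in>L. orthogonal n x)"

definition is_basis4 :: "(nat \<Rightarrow> real^4) \<Rightarrow> bool" where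
  "is_basis4 w \<longleftrightarrow> independent_family w {1..4} \<and> span (w ` {1..4}) = UNIV"

definition dual_basis4 :: "(nat \<Rightarrow> real^4) \<Rightarrow> (nat \<Rightarrow> real^4) \<Rightarrow> bool" where
  "dual_basis4 w ws \<longleftrightarrow>
     (\<forall>i\<in>{1..4}. \<forall>j\<in>{1..4}. ws i \<bullet> w j = (if i = j then 1 else 0))"

definition Q_comp :: "(nat \<Rightarrow> real^4) \<Rightarrow> (nat \<Rightarrow> real^4) \<Rightarrow> nat \<Rightarrow> real^4 \<Rightarrow> real" where
  "Q_comp u v i x = (x \<bullet> u i) * (x \<bullet> v i)"

definition Q_form ::
    "(nat \<Rightarrow> real^4) \<Rightarrow> (nat \<Rightarrow> real^4) \<Rightarrow> (nat \<Rightarrow> real) \<Rightarrow> real^4 \<Rightarrow> real" where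
  "Q_form u v \<alpha> x = (\<Sum>j=1..4. \<alpha> j * Q_comp u v j x)"

definition R_form :: "(nat \<Rightarrow> real^4) \<Rightarrow> real^4 \<Rightarrow> real" where
  "R_form u x = (\<Prod>j=1..4. x \<bullet> u j)"

end

theory Submission
  imports Defs
begin

text \<open>
  The two identities are the evaluation of a sum with one surviving term. Since \<open>us i\<close> is
  orthogonal to every \<open>u j\<close> with \<open>j \<noteq> i\<close>, only the \<open>i\<close>-th summand of \<open>Q\<close> survives at
  \<open>us i\<close>, so \<open>Q (us i) = \<alpha>\<^sub>i \<langle>us i, v i\<rangle>\<close>; symmetrically
  \<open>Q (vs i) = \<alpha>\<^sub>i \<langle>vs i, u i\<rangle>\<close>. Both sides of the first identity are thus
  \<open>\<alpha>\<^sub>i \<langle>us i, v i\<rangle> \<langle>vs i, u i\<rangle>\<close>.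

  For the quartic form, \<open>R (us i) = 0\<close> for the same reason, so the claim is that
  \<open>\<langle>us i, v i\<rangle>\<close> and all four numbers \<open>\<langle>vs i, u j\<rangle>\<close> are nonzero. This is where general
  position and the double covering enter. Put \<open>x = vs i\<close>, which lies on the hyperplane
  \<open>L\<^sub>k\<close> of the complement of \<open>T k\<close> for all \<open>k \<noteq> i\<close>, and suppose that \<open>x\<close> lies on the hyperplane
  of \<open>T j\<close> too. Then \<open>x\<close> is a combination of the three vectors indexed by \<open>T j\<close>. Each
  \<open>p \<in> T j\<close> is the unique common element of \<open>T j\<close> and some other \<open>T k\<close>, so \<open>s p\<close> is the
  only one of the three vectors off \<open>L\<^sub>k\<close>; if \<open>k \<noteq> i\<close>, this kills its coefficient in \<open>x\<close>.
  The single vector that may remain, for \<open>k = i\<close>, lies off \<open>L\<^sub>j\<close> because its index is in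
  \<open>T j\<close>, while \<open>x\<close> lies on \<open>L\<^sub>j\<close> because then \<open>j \<noteq> i\<close>. So \<open>x = 0\<close>, which is absurd
  for a member of a dual basis. This is lemma \<open>eq_zero_if_orthogonal_normals\<close>. Complements
  of a double covering form a double covering again, so the same lemma with the roles of
  \<open>u\<close> and \<open>v\<close> exchanged gives \<open>\<langle>us i, v i\<rangle> \<noteq> 0\<close>.
\<close>

lemma exists_lincomb_of_four:
  assumes "general_linear_position s" and "B \<subseteq> {1..6}" and "card B = 4"
  shows "\<exists>a. x = (\<Sum>k\<in>B. a k *\<^sub>R s k)"
proof -
  have inj: "inj_on s B" and ind: "independent (s ` B)"
    using assms unfolding general_linear_position_def independent_family_def by auto
  have fin: "finite B" using assms(2) finite_subset by blast
  have "span (s ` B) = UNIV"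
    using ind inj assms(3) card_eq_dim[of "s ` B" UNIV] fin by (auto simp: card_image)
  then have "x \<in> span (s ` B)" by simp
  then obtain c where "x = (\<Sum>v\<in>s ` B. c v *\<^sub>R v)"
    using span_finite[of "s ` B"] fin by auto
  then have "x = (\<Sum>k\<in>B. c (s k) *\<^sub>R s k)"
    using inj by (simp add: sum.reindex)
  then show ?thesis by (rule exI[of _ "\<lambda>k. c (s k)"])
qed

lemma unit_normal_inner_eq_zero:
  assumes "unit_normal n (hyperplane_of s A)" and "k \<in> A"
  shows "s k \<bullet> n = 0"
  using assms unfolding unit_normal_def hyperplane_of_def orthogonal_def
  by (metis image_eqI inner_commute span_base)

text \<open>The four vectors indexed by \<open>A\<close> and \<open>p\<close> span the whole space, so a normal vector
  orthogonal to all of them would be orthogonal to itself.\<close>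

lemma unit_normal_inner_nonzero:
  assumes "general_linear_position s" and "A \<subseteq> {1..6}" and "card A = 3"
    and "unit_normal n (hyperplane_of s A)" and "p \<in> {1..6} - A"
  shows "s p \<bullet> n \<noteq> 0"
proof
  assume p: "s p \<bullet> n = 0"
  have "finite A" using assms(2) finite_subset by blast
  then obtain a where a: "n = (\<Sum>k\<in>insert p A. a k *\<^sub>R s k)"
    using exists_lincomb_of_four[of s "insert p A" n] assms by auto
  have "n \<bullet> n = (\<Sum>k\<in>insert p A. a k * (s k \<bullet> n))"
    by (subst (1) a) (simp add: inner_sum_left)
  also have "\<dots> = 0"
    using p unit_normal_inner_eq_zero[OF assms(4)] by (intro sum.neutral) auto
  finally show False using assms(4) unfolding unit_normal_def by auto
qed

text \<open>A vector orthogonal to the normal lies on the hyperplane itself: in a basis obtained by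
  adding one further \<open>s p\<close>, the coefficient of \<open>s p\<close> is detected by the normal.\<close>

lemma exists_lincomb_of_orthogonal_normal:
  assumes "general_linear_position s" and "A \<subseteq> {1..6}" and "card A = 3"
    and "unit_normal n (hyperplane_of s A)" and "x \<bullet> n = 0"
  shows "\<exists>a. x = (\<Sum>k\<in>A. a k *\<^sub>R s k)"
proof -
  have fin: "finite A" using assms(2) finite_subset by blast
  have "\<not> {1..6} \<subseteq> A" using card_mono[OF fin, of "{1..6}"] assms(3) by auto
  then obtain p where p: "p \<in> {1..6} - A" by blast
  then obtain a where a: "x = (\<Sum>k\<in>insert p A. a k *\<^sub>R s k)"
    using exists_lincomb_of_four[of s "insert p A" x] assms fin by auto
  have "0 = (\<Sum>k\<in>insert p A. a k * (s k \<bullet> n))"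
    using assms(5) unfolding a by (simp add: inner_sum_left)
  also have "\<dots> = a p * (s p \<bullet> n)"
    using fin p unit_normal_inner_eq_zero[OF assms(4)] by (simp add: sum.neutral)
  finally have "a p = 0"
    using unit_normal_inner_nonzero[OF assms(1-4) p] by simp
  then have "x = (\<Sum>k\<in>A. a k *\<^sub>R s k)" using a fin p by simp
  then show ?thesis by blast
qed

lemma double_covering_triple:
  assumes "double_covering T" and "i \<in> {1..4}"
  shows "T i \<subseteq> {1..6}" and "card (T i) = 3"
  using assms unfolding double_covering_def by auto

lemma double_covering_obtain_partner:
  assumes "double_covering T" and "j \<in> {1..4}" and "p \<in> T j"
  obtains k where "k \<in> {1..4}" "k \<noteq> j" "T j \<inter> T k = {p}"
proof -
  have "p \<in> {1..6}" using double_covering_triple[OF assms(1,2)] assms(3) by auto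
  then have "card {i\<in>{1..4}. p \<in> T i} = 2"
    using assms(1) unfolding double_covering_def by blast
  then obtain a b where ab: "{i\<in>{1..4}. p \<in> T i} = {a, b}" "a \<noteq> b"
    by (auto simp: card_2_iff)
  then obtain k where k: "k \<in> {1..4}" "p \<in> T k" "k \<noteq> j"
    by blast
  then have "card (T j \<inter> T k) = 1"
    using assms unfolding double_covering_def by metis
  then have "T j \<inter> T k = {p}"
    using k(2) assms(3) by (metis IntI card_1_singletonE singletonD)
  then show ?thesis using that k by blast
qed

text \<open>Inclusion and exclusion: two triples with one common element cover five of the six
  indices, so their complements share one index; an index in two of the four triples is in two
  of the four complements.\<close>

lemma double_covering_complement:
  assumes "double_covering T"
  shows "double_covering (\<lambda>i. {1..6} - T i)"
  unfolding double_covering_def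
proof (intro conjI ballI impI)
  fix i :: nat assume "i \<in> {1..4}"
  note t = double_covering_triple[OF assms this]
  show "{1..6} - T i \<subseteq> {1..6}" by blast
  show "card ({1..6} - T i) = 3"
    using t by (subst card_Diff_subset) (auto intro: finite_subset)
next
  fix i j :: nat assume i: "i \<in> {1..4}" and j: "j \<in> {1..4}" and ij: "i \<noteq> j"
  note ti = double_covering_triple[OF assms i] and tj = double_covering_triple[OF assms j]
  have fin: "finite (T i)" "finite (T j)" using ti tj finite_subset by blast+
  have "card (T i \<inter> T j) = 1" using assms i j ij unfolding double_covering_def by blast
  then have "card (T i \<union> T j) = 5" using card_Un_Int[OF fin] ti tj by simp
  moreover have "({1..6} - T i) \<inter> ({1..6} - T j) = {1..6} - (T i \<union> T j)" by blast
  ultimately show "card (({1..6} - T i) \<inter> ({1..6} - T j)) = 1"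
    using fin ti tj by (simp add: card_Diff_subset)
next
  fix k :: nat assume k: "k \<in> {1..6}"
  have "{i\<in>{1..4}. k \<in> {1..6} - T i} = {1..4} - {i\<in>{1..4}. k \<in> T i}" using k by blast
  moreover have "card {i\<in>{1..4}. k \<in> T i} = 2"
    using assms k unfolding double_covering_def by blast
  moreover have "card ({1..4} - {i\<in>{1..4}. k \<in> T i}) = card {1..4::nat} - card {i\<in>{1..4}. k \<in> T i}"
    by (rule card_Diff_subset) auto
  ultimately show "card {i\<in>{1..4}. k \<in> {1..6} - T i} = 2" by simp
qed

text \<open>Each of the three normals \<open>v k\<close> cuts one term off the expansion of \<open>x\<close> in the vectors
  indexed by \<open>T j\<close>: for \<open>k \<noteq> j\<close> the term of the common element of \<open>T j\<close> and \<open>T k\<close>, and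
  \<open>v j\<close>, which sees all three vectors, the last term left when \<open>j \<noteq> i\<close>. The case \<open>j = i\<close>
  is included because both kinds of inner products occur in the comparison of the quartic
  form at \<open>us i\<close> and \<open>vs i\<close>.\<close>

lemma eq_zero_if_orthogonal_normals:
  assumes gp: "general_linear_position s" and dc: "double_covering T"
    and j: "j \<in> {1..4}" and n: "unit_normal n (hyperplane_of s (T j))"
    and v: "\<forall>k\<in>{1..4}. unit_normal (v k) (hyperplane_of s ({1..6} - T k))"
    and xn: "x \<bullet> n = 0" and xv: "\<And>k. k \<in> {1..4} \<Longrightarrow> k \<noteq> i \<Longrightarrow> x \<bullet> v k = 0"
  shows "x = 0"
proof -
  note tj = double_covering_triple[OF dc j]
  have fin: "finite (T j)" using tj(1) finite_subset by blast
  obtain a where a: "x = (\<Sum>p\<in>T j. a p *\<^sub>R s p)"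
    using exists_lincomb_of_orthogonal_normal[OF gp tj n xn] by blast
  have off: "s p \<bullet> v k \<noteq> 0" if "k \<in> {1..4}" "p \<in> T k" for p k
    using that double_covering_triple[OF double_covering_complement[OF dc] that(1)] v
      double_covering_triple[OF dc that(1)]
    by (intro unit_normal_inner_nonzero[OF gp, of "{1..6} - T k"]) auto
  have on: "s p \<bullet> v k = 0" if "k \<in> {1..4}" "p \<in> {1..6} - T k" for p k
    using that v unit_normal_inner_eq_zero by blast
  \<comment> \<open>A normal \<open>v k\<close> orthogonal to \<open>x\<close> that sees only one summand of \<open>x\<close> kills that summand.\<close>
  have single: "a p = 0"
    if "p \<in> T j" "k \<in> {1..4}" "k \<noteq> i" "p \<in> T k"
      and others: "\<And>q. q \<in> T j \<Longrightarrow> q \<noteq> p \<Longrightarrow> a q * (s q \<bullet> v k) = 0" for p k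
  proof -
    have "0 = (\<Sum>q\<in>T j. a q * (s q \<bullet> v k))"
      using xv[OF that(2,3)] unfolding a by (simp add: inner_sum_left)
    also have "\<dots> = a p * (s p \<bullet> v k) + (\<Sum>q\<in>T j - {p}. a q * (s q \<bullet> v k))"
      using fin that(1) by (rule sum.remove)
    also have "(\<Sum>q\<in>T j - {p}. a q * (s q \<bullet> v k)) = 0"
      using others by (intro sum.neutral) auto
    finally show ?thesis using off[OF that(2,4)] by simp
  qed
  have partner: "a p = 0" if "k \<in> {1..4}" "k \<noteq> i" "T j \<inter> T k = {p}" for p k
  proof (rule single[of p k])
    fix q assume q: "q \<in> T j" "q \<noteq> p"
    then have "q \<in> {1..6} - T k" using that(3) tj(1) by blast
    then show "a q * (s q \<bullet> v k) = 0" using on[OF that(1)] by simp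
  qed (use that in blast)+
  have "a p = 0" if p: "p \<in> T j" for p
  proof -
    obtain k where k: "k \<in> {1..4}" "k \<noteq> j" "T j \<inter> T k = {p}"
      using double_covering_obtain_partner[OF dc j p] by blast
    show ?thesis
    proof (cases "k = i")
      case False
      then show ?thesis using partner k by blast
    next
      case True
      \<comment> \<open>The partners of the other two indices differ from \<open>i\<close>, because \<open>T i\<close> meets \<open>T j\<close>
        in \<open>p\<close> alone; so \<open>s p\<close> is the last summand, and \<open>v j\<close> sees it.\<close>
      have "a q = 0" if q: "q \<in> T j" "q \<noteq> p" for q
      proof -
        obtain m where "m \<in> {1..4}" "T j \<inter> T m = {q}"
          using double_covering_obtain_partner[OF dc j q(1)] by blast
        then show ?thesis using partner[of m q] k(3) True q(2) by blast
      qed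
      then show ?thesis using single[OF p j _ p] True k(2) by simp
    qed
  qed
  then show "x = 0" using a by simp
qed

text \<open>Used twice: as it stands it makes every factor of \<open>R\<close> at \<open>vs i\<close> nonzero; with the
  complements in place of the triples it concerns \<open>us i\<close> and \<open>v i\<close>.\<close>

lemma dual_basis_inner_normal_nonzero:
  assumes "general_linear_position s" and "double_covering T"
    and "j \<in> {1..4}" and "unit_normal n (hyperplane_of s (T j))"
    and "\<forall>k\<in>{1..4}. unit_normal (v k) (hyperplane_of s ({1..6} - T k))"
    and "dual_basis4 v vs" and "i \<in> {1..4}"
  shows "vs i \<bullet> n \<noteq> 0"
proof
  assume "vs i \<bullet> n = 0"
  then have "vs i = 0"
    using assms by (intro eq_zero_if_orthogonal_normals[OF assms(1-5), of "vs i" i])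
      (auto simp: dual_basis4_def)
  moreover have "vs i \<bullet> v i = 1" using assms(6,7) by (simp add: dual_basis4_def)
  ultimately show False by simp
qed

lemma Q_form_swap: "Q_form u v \<alpha> = Q_form v u \<alpha>"
  by (simp add: fun_eq_iff Q_form_def Q_comp_def mult.commute)

lemma Q_form_dual_basis:
  assumes "dual_basis4 u us" and "i \<in> {1..4}"
  shows "Q_form u v \<alpha> (us i) = \<alpha> i * (us i \<bullet> v i)"
proof -
  have "Q_form u v \<alpha> (us i) = (\<Sum>j=1..4. if i = j then \<alpha> i * (us i \<bullet> v i) else 0)"
    unfolding Q_form_def Q_comp_def
    using assms by (intro sum.cong) (auto simp: dual_basis4_def)
  then show ?thesis using assms(2) by simp
qed

lemma R_form_dual_basis:
  assumes "dual_basis4 u us" and "i \<in> {1..4}"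
  shows "R_form u (us i) = 0"
proof -
  have "\<exists>j\<in>{1..4}. j \<noteq> i" by (cases "i = 1") force+
  then show ?thesis
    using assms unfolding R_form_def dual_basis4_def by auto
qed

theorem proposition6p5:
  fixes s u v us vs :: "nat \<Rightarrow> real^4"
    and T :: "nat \<Rightarrow> nat set"
    and \<alpha> :: "nat \<Rightarrow> real"
  assumes "general_linear_position s"
    and "double_covering T"
    and "\<forall>i\<in>{1..4}. unit_normal (u i) (hyperplane_of s (T i))"
    and "\<forall>i\<in>{1..4}. unit_normal (v i) (hyperplane_of s ({1..6} - T i))"
    and "is_basis4 u"
    and "is_basis4 v"
    and "dual_basis4 u us"
    and "dual_basis4 v vs"
  shows "(\<forall>i\<in>{1..4}.
            (vs i \<bullet> u i) * Q_form u v \<alpha> (us i) = (us i \<bullet> v i) * Q_form u v \<alpha> (vs i)) \<and>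
         (\<forall>i\<in>{1..4}.
            (vs i \<bullet> u i)\<^sup>2 * (Q_form u v \<alpha> (us i))\<^sup>2
              = (us i \<bullet> v i)\<^sup>2 * (Q_form u v \<alpha> (vs i))\<^sup>2) \<and>
         (\<forall>i\<in>{1..4}.
            (vs i \<bullet> u i)\<^sup>2 * R_form u (us i) \<noteq> (us i \<bullet> v i)\<^sup>2 * R_form u (vs i))"
proof (intro conjI ballI)
  fix i :: nat assume i: "i \<in> {1..4}"
  have Qu: "Q_form u v \<alpha> (us i) = \<alpha> i * (us i \<bullet> v i)"
    using Q_form_dual_basis[OF assms(7) i] .
  have Qv: "Q_form u v \<alpha> (vs i) = \<alpha> i * (vs i \<bullet> u i)"
    using Q_form_dual_basis[OF assms(8) i] by (simp add: Q_form_swap[of u v])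
  show "(vs i \<bullet> u i) * Q_form u v \<alpha> (us i) = (us i \<bullet> v i) * Q_form u v \<alpha> (vs i)"
    by (simp add: Qu Qv)
  then show "(vs i \<bullet> u i)\<^sup>2 * (Q_form u v \<alpha> (us i))\<^sup>2
      = (us i \<bullet> v i)\<^sup>2 * (Q_form u v \<alpha> (vs i))\<^sup>2"
    by (simp flip: power_mult_distrib)
  have "vs i \<bullet> u j \<noteq> 0" if "j \<in> {1..4}" for j
    using dual_basis_inner_normal_nonzero[OF assms(1,2) that _ assms(4,8) i] assms(3) that
    by blast
  then have "R_form u (vs i) \<noteq> 0" unfolding R_form_def by simp
  moreover have "us i \<bullet> v i \<noteq> 0"
  proof (rule dual_basis_inner_normal_nonzero[OF assms(1)
        double_covering_complement[OF assms(2)] i _ _ assms(7) i])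
    show "unit_normal (v i) (hyperplane_of s ({1..6} - T i))" using assms(4) i by blast
    have "{1..6} - ({1..6} - T k) = T k" if "k \<in> {1..4}" for k
      using double_covering_triple(1)[OF assms(2) that] by blast
    then show "\<forall>k\<in>{1..4}. unit_normal (u k) (hyperplane_of s ({1..6} - ({1..6} - T k)))"
      using assms(3) by simp
  qed
  ultimately show "(vs i \<bullet> u i)\<^sup>2 * R_form u (us i) \<noteq> (us i \<bullet> v i)\<^sup>2 * R_form u (vs i)"
    using R_form_dual_basis[OF assms(7) i] by simp
qed

end
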